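(* Let $T>0$, $X=[0,T]$, $d\ge 1$, and let $\mathcal{H}_K$ be an $\mathbb{R}^d$-valued reproducing kernel Hilbert space on $X$ whose reproducing kernel $K:X\times X\to\mathbb{R}^{d\times d}$ is continuous. Let $(t_1,\tilde{\boldsymbol{y}}_1),\dots,(t_n,\tilde{\boldsymbol{y}}_n)\in X\times\mathbb{R}^d$ be data pairs, let $\mathcal{L}_1,\dots,\mathcal{L}_n:\mathcal{H}_K\to\mathbb{R}^d$ be the linear operators $\mathcal{L}_i(\boldsymbol{\phi})=\int_0^{t_i}\boldsymbol{\phi}(s)\,ds$ (componentwise integral), and let $\lambda>0$. Then the regularization problem $$\min_{\boldsymbol{\phi}\in\mathcal{H}_K} J(\boldsymbol{\phi}):=\sum_{i=1}^{n}\|\mathcal{L}_i(\boldsymbol{\phi})-\tilde{\boldsymbol{y}}_i\|_2^2+\lambda\|\boldsymbol{\phi}\|_{\mathcal{H}_K}^2$$ has at least one solution, and any solution $\boldsymbol{\phi}^*$ must have the representation $$\boldsymbol{\phi}^*=\sum_{i=1}^{n}\mathcal{L}_i(\Phi(\cdot,v_i))$$ for some $v_1,\dots,v_n\in\mathbb{R}^d$.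
   Context: An $\mathbb{R}^d$-valued reproducing kernel on $X$ is a map $K:X\times X\to\mathbb{R}^{d\times d}$ such that $K(x,x')=K(x',x)^{\top}$ for all $x,x'\in X$, and $\sum_{i,j=1}^{N}\langle K(x_i,x_j)z_j,z_i\rangle_2\ge 0$ for all $N$, all $x_1,\dots,x_N\in X$ and all $z_1,\dots,z_N\in\mathbb{R}^d$, where $\langle\cdot,\cdot\rangle_2$ is the Euclidean inner product on $\mathbb{R}^d$ (with norm $\|\cdot\|_2$). The associated $\mathbb{R}^d$-valued reproducing kernel Hilbert space $\mathcal{H}_K$ is the unique Hilbert space of functions $X\to\mathbb{R}^d$ such that (1) for every $x'\in X$, $v\in\mathbb{R}^d$ the function $K(\cdot,x')v$ lies in $\mathcal{H}_K$, and (2) $\langle\varphi,K(\cdot,x)v\rangle_{\mathcal{H}_K}=\langle\varphi(x),v\rangle_2$ for all $x\in X$, $v\in\mathbb{R}^d$, $\varphi\in\mathcal{H}_K$. When $K$ is continuous, all elements of $\mathcal{H}_K$ are continuous functions. The feature map is $\Phi:X\times\mathbb{R}^d\to\mathcal{H}_K$, $\Phi(x,v)=K(\cdot,x)v$. The notation $\mathcal{L}_i(\Phi(\cdot,v))$ means the function on $X$ obtained by integrating in the first argument of $\Phi$: $\mathcal{L}_i(\Phi(\cdot,v))(t)=\int_0^{t_i}K(t,s)v\,ds$ for $t\in[0,T]$; it is an element of $\mathcal{H}_K$. *)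

theory Defs
  imports "HOL-Analysis.Analysis"
begin

text \<open>
  Functions on a set \<open>X\<close> are represented by total functions that are \<open>0\<close> outside \<open>X\<close>, so that
  equality of the representing functions is equality on \<open>X\<close> and the pointwise vector space
  operations stay inside this class.
\<close>

definition reproducing_kernel :: "'x set \<Rightarrow> ('x \<Rightarrow> 'x \<Rightarrow> real^'d^'d) \<Rightarrow> bool" where
  "reproducing_kernel X K \<longleftrightarrow>
     (\<forall>x\<in>X. \<forall>x'\<in>X. K x x' = transpose (K x' x)) \<and>
     (\<forall>(N::nat) (x :: nat \<Rightarrow> 'x) (z :: nat \<Rightarrow> real^'d).
        (\<forall>i\<in>{1..N}. x i \<in> X) \<longrightarrow>
        0 \<le> (\<Sum>i=1..N. \<Sum>j=1..N. (K (x i) (x j) *v z j) \<bullet> z i))"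

text \<open>
  A Hilbert space of functions is given by its carrier \<open>H\<close> and its inner product \<open>ip\<close>, whose values
  are relevant on \<open>H\<close> only.
\<close>

definition hilbert_norm :: "('f \<Rightarrow> 'f \<Rightarrow> real) \<Rightarrow> 'f \<Rightarrow> real" where
  "hilbert_norm ip f = sqrt (ip f f)"

definition hilbert_function_space ::
  "'x set \<Rightarrow> ('x \<Rightarrow> real^'d) set \<Rightarrow> (('x \<Rightarrow> real^'d) \<Rightarrow> ('x \<Rightarrow> real^'d) \<Rightarrow> real) \<Rightarrow> bool" where
  "hilbert_function_space X H ip \<longleftrightarrow>
     (\<forall>f\<in>H. \<forall>x. x \<notin> X \<longrightarrow> f x = 0) \<and>
     (\<lambda>x. 0) \<in> H \<and>
     (\<forall>f\<in>H. \<forall>g\<in>H. (\<lambda>x. f x + g x) \<in> H) \<and>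
     (\<forall>c. \<forall>f\<in>H. (\<lambda>x. c *\<^sub>R f x) \<in> H) \<and>
     (\<forall>f\<in>H. \<forall>g\<in>H. ip f g = ip g f) \<and>
     (\<forall>f\<in>H. \<forall>g\<in>H. \<forall>h\<in>H. ip (\<lambda>x. f x + g x) h = ip f h + ip g h) \<and>
     (\<forall>c. \<forall>f\<in>H. \<forall>g\<in>H. ip (\<lambda>x. c *\<^sub>R f x) g = c * ip f g) \<and>
     (\<forall>f\<in>H. 0 \<le> ip f f) \<and>
     (\<forall>f\<in>H. ip f f = 0 \<longrightarrow> f = (\<lambda>x. 0)) \<and>
     (\<forall>\<sigma>. (\<forall>k::nat. \<sigma> k \<in> H) \<longrightarrow>
        (\<forall>e>0. \<exists>M. \<forall>m\<ge>M. \<forall>k\<ge>M. hilbert_norm ip (\<lambda>x. \<sigma> m x - \<sigma> k x) < e) \<longrightarrow>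
        (\<exists>f\<in>H. (\<lambda>k. hilbert_norm ip (\<lambda>x. \<sigma> k x - f x)) \<longlonglongrightarrow> 0))"

definition feature_map :: "'x set \<Rightarrow> ('x \<Rightarrow> 'x \<Rightarrow> real^'d^'d) \<Rightarrow> 'x \<Rightarrow> real^'d \<Rightarrow> ('x \<Rightarrow> real^'d)" where
  "feature_map X K x v = (\<lambda>x'. if x' \<in> X then K x' x *v v else 0)"

definition is_rkhs ::
  "'x set \<Rightarrow> ('x \<Rightarrow> 'x \<Rightarrow> real^'d^'d) \<Rightarrow> ('x \<Rightarrow> real^'d) set
     \<Rightarrow> (('x \<Rightarrow> real^'d) \<Rightarrow> ('x \<Rightarrow> real^'d) \<Rightarrow> real) \<Rightarrow> bool" where
  "is_rkhs X K H ip \<longleftrightarrow>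
     reproducing_kernel X K \<and>
     hilbert_function_space X H ip \<and>
     (\<forall>x\<in>X. \<forall>v. feature_map X K x v \<in> H) \<and>
     (\<forall>x\<in>X. \<forall>v. \<forall>\<phi>\<in>H. ip \<phi> (feature_map X K x v) = \<phi> x \<bullet> v)"

definition integral_op :: "real \<Rightarrow> (real \<Rightarrow> real^'d) \<Rightarrow> real^'d" where
  "integral_op \<tau> \<phi> = integral {0..\<tau>} \<phi>"

text \<open>
  The operator applied in the first argument of the feature map, as a function of the remaining
  evaluation point: \<open>\<L>(\<Phi>(\<cdot>,v))(u) = \<integral>\<^sub>0\<^sup>\<tau> K(u,s) v ds\<close>.
\<close>

definition integral_feature ::
  "real set \<Rightarrow> (real \<Rightarrow> real \<Rightarrow> real^'d^'d) \<Rightarrow> real \<Rightarrow> real^'d \<Rightarrow> (real \<Rightarrow> real^'d)" where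
  "integral_feature X K \<tau> v = (\<lambda>u. integral_op \<tau> (\<lambda>s. feature_map X K s v u))"

definition regularized_risk ::
  "((real \<Rightarrow> real^'d) \<Rightarrow> (real \<Rightarrow> real^'d) \<Rightarrow> real) \<Rightarrow> nat \<Rightarrow> (nat \<Rightarrow> real) \<Rightarrow> (nat \<Rightarrow> real^'d) \<Rightarrow> real
     \<Rightarrow> (real \<Rightarrow> real^'d) \<Rightarrow> real" where
  "regularized_risk ip n t y lam \<phi> =
     (\<Sum>i=1..n. (norm (integral_op (t i) \<phi> - y i))\<^sup>2) + lam * (hilbert_norm ip \<phi>)\<^sup>2"

end

theory Submission
  imports Defs
begin

text \<open>
  The risk \<open>J\<close> is a nonnegative quadratic functional on \<open>H\<close> whose modulus of convexity is at least
  that of \<open>\<lambda>\<parallel>\<cdot>\<parallel>\<^sup>2\<close>; hence every minimizing sequence is Cauchy, and its limit is a minimizer because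
  the integral operators are bounded on \<open>H\<close>. At a minimizer \<open>\<phi>\<close> the first variation vanishes,
  \<open>\<Sum>\<^sub>i (\<L>\<^sub>i \<phi> - y\<^sub>i) \<bullet> \<L>\<^sub>i h + \<lambda>\<langle>\<phi>, h\<rangle> = 0\<close> for all \<open>h \<in> H\<close>. Testing with \<open>h = \<Phi>(u, w)\<close> turns
  \<open>\<langle>\<phi>, h\<rangle>\<close> into \<open>\<phi>(u) \<bullet> w\<close>, and the symmetry of \<open>K\<close> moves \<open>w\<close> out of the integrals, so the
  representation holds with \<open>v\<^sub>i = (y\<^sub>i - \<L>\<^sub>i \<phi>) / \<lambda>\<close>.
\<close>

section \<open>Hilbert function spaces\<close>

locale hilbert_functions =
  fixes X :: "'x set" and H :: "('x \<Rightarrow> real^'d) set"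
    and ip :: "('x \<Rightarrow> real^'d) \<Rightarrow> ('x \<Rightarrow> real^'d) \<Rightarrow> real"
  assumes hilbert: "hilbert_function_space X H ip"
begin

lemma outside: "f \<in> H \<Longrightarrow> x \<notin> X \<Longrightarrow> f x = 0"
  and zero_mem: "(\<lambda>x. 0) \<in> H"
  and add_mem: "f \<in> H \<Longrightarrow> g \<in> H \<Longrightarrow> (\<lambda>x. f x + g x) \<in> H"
  and scale_mem: "f \<in> H \<Longrightarrow> (\<lambda>x. c *\<^sub>R f x) \<in> H"
  and ip_commute: "f \<in> H \<Longrightarrow> g \<in> H \<Longrightarrow> ip f g = ip g f"
  and ip_add_left: "f \<in> H \<Longrightarrow> g \<in> H \<Longrightarrow> h \<in> H \<Longrightarrow> ip (\<lambda>x. f x + g x) h = ip f h + ip g h"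
  and ip_scale_left: "f \<in> H \<Longrightarrow> g \<in> H \<Longrightarrow> ip (\<lambda>x. c *\<^sub>R f x) g = c * ip f g"
  and ip_nonneg: "f \<in> H \<Longrightarrow> 0 \<le> ip f f"
  and ip_eq_zeroD: "f \<in> H \<Longrightarrow> ip f f = 0 \<Longrightarrow> f = (\<lambda>x. 0)"
  and complete: "(\<And>k::nat. \<sigma> k \<in> H) \<Longrightarrow>
    (\<And>e. e > 0 \<Longrightarrow> \<exists>M. \<forall>m\<ge>M. \<forall>k\<ge>M. hilbert_norm ip (\<lambda>x. \<sigma> m x - \<sigma> k x) < e) \<Longrightarrow>
    \<exists>f\<in>H. (\<lambda>k. hilbert_norm ip (\<lambda>x. \<sigma> k x - f x)) \<longlonglongrightarrow> 0"
  using hilbert unfolding hilbert_function_space_def by blast+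

section \<open>Algebra of the inner product on the carrier\<close>

lemma ip_add_right:
  "f \<in> H \<Longrightarrow> g \<in> H \<Longrightarrow> h \<in> H \<Longrightarrow> ip h (\<lambda>x. f x + g x) = ip h f + ip h g"
  by (simp add: ip_commute[of h] ip_add_left add_mem)

lemma ip_scale_right: "f \<in> H \<Longrightarrow> g \<in> H \<Longrightarrow> ip f (\<lambda>x. c *\<^sub>R g x) = c * ip f g"
  by (simp add: ip_commute[of f] ip_scale_left scale_mem)

lemma lincomb_mem:
  assumes "f \<in> H" "g \<in> H" shows "(\<lambda>x. f x + c *\<^sub>R g x) \<in> H"
  using add_mem[OF assms(1) scale_mem[OF assms(2), of c]] .

lemma ip_lincomb_right:
  assumes "f \<in> H" "g \<in> H" "h \<in> H"
  shows "ip h (\<lambda>x. f x + c *\<^sub>R g x) = ip h f + c * ip h g"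
  using assms ip_add_right[OF assms(1) scale_mem[OF assms(2), of c] assms(3)]
  by (simp add: ip_scale_right)

text \<open>Bilinearity and symmetry. Differences are the case \<open>c = -1\<close>; keeping
  \<open>c\<close> free serves the Cauchy-Schwarz inequality and the expansion of the risk along
  lines.\<close>

lemma ip_lincomb_self:
  assumes "f \<in> H" "g \<in> H"
  shows "ip (\<lambda>x. f x + c *\<^sub>R g x) (\<lambda>x. f x + c *\<^sub>R g x) = ip f f + 2 * c * ip f g + c\<^sup>2 * ip g g"
proof -
  have "ip (\<lambda>x. f x + c *\<^sub>R g x) k = ip f k + c * ip g k" if "k \<in> H" for k
    using ip_lincomb_right[OF assms that, of c] that assms
    by (simp add: ip_commute[of _ k] lincomb_mem)
  then show ?thesis
    using assms by (simp add: lincomb_mem ip_lincomb_right ip_commute[of g f] power2_eq_square algebra_simps)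
qed

lemma diff_mem: "f \<in> H \<Longrightarrow> g \<in> H \<Longrightarrow> (\<lambda>x. f x - g x) \<in> H"
  using lincomb_mem[of f g "-1"] by simp

lemma ip_diff_right:
  "f \<in> H \<Longrightarrow> g \<in> H \<Longrightarrow> h \<in> H \<Longrightarrow> ip h (\<lambda>x. f x - g x) = ip h f - ip h g"
  using ip_lincomb_right[of f g h "-1"] by simp

lemma ip_diff_self:
  "f \<in> H \<Longrightarrow> g \<in> H \<Longrightarrow> ip (\<lambda>x. f x - g x) (\<lambda>x. f x - g x) = ip f f - 2 * ip f g + ip g g"
  using ip_lincomb_self[of f g "-1"] by simp

lemma hilbert_norm_nonneg: "f \<in> H \<Longrightarrow> 0 \<le> hilbert_norm ip f"
  by (simp add: hilbert_norm_def ip_nonneg)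

lemma hilbert_norm_square: "f \<in> H \<Longrightarrow> (hilbert_norm ip f)\<^sup>2 = ip f f"
  by (simp add: hilbert_norm_def ip_nonneg)

lemma Cauchy_Schwarz:
  assumes "f \<in> H" "g \<in> H"
  shows "\<bar>ip f g\<bar> \<le> hilbert_norm ip f * hilbert_norm ip g"
proof (cases "ip g g = 0")
  case True
  then have "g = (\<lambda>x. 0)" using ip_eq_zeroD assms by blast
  then have "ip f g = 0" using ip_scale_right[OF assms(1) zero_mem, of 0] by simp
  then show ?thesis using assms by (simp add: hilbert_norm_nonneg)
next
  case False
  then have pos: "ip g g > 0" using ip_nonneg[OF assms(2)] by linarith
  \<comment> \<open>The minimizer of the quadratic polynomial
    \<open>c \<mapsto> ip f f + 2 * c * ip f g + c\<^sup>2 * ip g g\<close>.\<close>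
  define c where "c = - (ip f g / ip g g)"
  have "0 \<le> ip f f + 2 * c * ip f g + c\<^sup>2 * ip g g"
    using ip_nonneg[OF lincomb_mem[OF assms, of c]] ip_lincomb_self[OF assms] by simp
  also have "\<dots> = ip f f - (ip f g)\<^sup>2 / ip g g"
    using pos by (simp add: c_def power2_eq_square field_simps)
  finally have "(ip f g)\<^sup>2 \<le> ip f f * ip g g"
    using pos by (simp add: field_simps)
  then have "\<bar>ip f g\<bar>\<^sup>2 \<le> (hilbert_norm ip f * hilbert_norm ip g)\<^sup>2"
    using assms by (simp add: power_mult_distrib hilbert_norm_square)
  then show ?thesis
    using assms by (meson hilbert_norm_nonneg mult_nonneg_nonneg power2_le_imp_le)
qed

text \<open>Write \<open>\<sigma> k = f + d k\<close> and expand: the cross term tends to 0 by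
  Cauchy-Schwarz, the square of \<open>d k\<close> by assumption.\<close>

lemma tendsto_ip_self:
  assumes \<sigma>: "\<And>k. \<sigma> k \<in> H" and f: "f \<in> H"
    and lim: "(\<lambda>k. hilbert_norm ip (\<lambda>x. \<sigma> k x - f x)) \<longlonglongrightarrow> 0"
  shows "(\<lambda>k. ip (\<sigma> k) (\<sigma> k)) \<longlonglongrightarrow> ip f f"
proof -
  define d where "d k = (\<lambda>x. \<sigma> k x - f x)" for k
  have d: "d k \<in> H" for k unfolding d_def by (intro diff_mem \<sigma> f)
  have "ip (\<sigma> k) (\<sigma> k) = ip f f + 2 * ip f (d k) + (hilbert_norm ip (d k))\<^sup>2" for k
    using ip_lincomb_self[OF f d, of 1 k] by (simp add: hilbert_norm_square d) (simp add: d_def)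
  moreover have d0: "(\<lambda>k. hilbert_norm ip (d k)) \<longlonglongrightarrow> 0" using lim by (simp add: d_def)
  moreover have "(\<lambda>k. ip f (d k)) \<longlonglongrightarrow> 0"
  proof (rule Lim_null_comparison)
    show "\<forall>\<^sub>F k in sequentially. norm (ip f (d k)) \<le> hilbert_norm ip f * hilbert_norm ip (d k)"
      using Cauchy_Schwarz[OF f d] by simp
    show "(\<lambda>k. hilbert_norm ip f * hilbert_norm ip (d k)) \<longlonglongrightarrow> 0"
      using tendsto_mult[OF tendsto_const d0] by simp
  qed
  ultimately show ?thesis
    by (auto intro!: tendsto_eq_intros)
qed

text \<open>The direct method: the midpoint of two near-minimizers cannot fall below the infimum, so
  the convexity gap forces them to be close. A minimizing sequence is therefore Cauchy, and by
  completeness and continuity its limit attains the infimum.\<close>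

lemma strongly_convex_has_arg_min:
  fixes J :: "('x \<Rightarrow> real^'d) \<Rightarrow> real"
  assumes nonneg: "\<And>f. f \<in> H \<Longrightarrow> 0 \<le> J f" and c: "c > 0"
    and convex: "\<And>f g. f \<in> H \<Longrightarrow> g \<in> H \<Longrightarrow>
      J (\<lambda>x. (1/2) *\<^sub>R (f x + g x)) \<le> (J f + J g) / 2 - c * ip (\<lambda>x. f x - g x) (\<lambda>x. f x - g x)"
    and cont: "\<And>\<sigma> f. (\<And>k. \<sigma> k \<in> H) \<Longrightarrow> f \<in> H \<Longrightarrow>
      (\<lambda>k. hilbert_norm ip (\<lambda>x. \<sigma> k x - f x)) \<longlonglongrightarrow> 0 \<Longrightarrow> (\<lambda>k. J (\<sigma> k)) \<longlonglongrightarrow> J f"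
  shows "\<exists>f. is_arg_min J (\<lambda>f. f \<in> H) f"
proof -
  define m where "m = Inf (J ` H)"
  have bdd: "bdd_below (J ` H)" using nonneg by (intro bdd_belowI[of _ 0]) auto
  have lower: "m \<le> J f" if "f \<in> H" for f
    unfolding m_def using bdd that by (auto intro: cInf_lower)
  have "\<exists>f\<in>H. J f < m + 1 / real (Suc k)" for k
  proof -
    have "Inf (J ` H) < m + 1 / real (Suc k)" by (simp add: m_def)
    then show ?thesis using cInf_lessD[of "J ` H"] zero_mem by blast
  qed
  then obtain \<sigma> where \<sigma>: "\<And>k. \<sigma> k \<in> H" and J\<sigma>: "\<And>k. J (\<sigma> k) < m + 1 / real (Suc k)"
    by metis
  have "\<exists>f\<in>H. (\<lambda>k. hilbert_norm ip (\<lambda>x. \<sigma> k x - f x)) \<longlonglongrightarrow> 0"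
  proof (rule complete[OF \<sigma>])
    fix e :: real assume e: "e > 0"
    \<comment> \<open>For \<open>k, l \<ge> M\<close> the mean of the two values is less than
      \<open>m + 1 / real (Suc M)\<close> and the midpoint value is at least \<open>m\<close>. So
      \<open>c\<close> times the squared distance is below \<open>1 / real (Suc M)\<close>, which
      has to be below \<open>c * e\<^sup>2\<close>.\<close>
    then obtain M where M: "1 / real (Suc M) < c * e\<^sup>2"
      using c reals_Archimedean[of "c * e\<^sup>2"] by (auto simp: inverse_eq_divide)
    have "hilbert_norm ip (\<lambda>x. \<sigma> k x - \<sigma> l x) < e" if "k \<ge> M" "l \<ge> M" for k l
    proof -
      have "1 / real (Suc k) \<le> 1 / real (Suc M)" "1 / real (Suc l) \<le> 1 / real (Suc M)"
        using that by (auto intro!: divide_left_mono)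
      moreover have "m \<le> J (\<lambda>x. (1/2) *\<^sub>R (\<sigma> k x + \<sigma> l x))"
        by (intro lower scale_mem add_mem \<sigma>)
      ultimately have "c * ip (\<lambda>x. \<sigma> k x - \<sigma> l x) (\<lambda>x. \<sigma> k x - \<sigma> l x) < c * e\<^sup>2"
        using convex[OF \<sigma> \<sigma>, of k l] J\<sigma>[of k] J\<sigma>[of l] M by argo
      then have "ip (\<lambda>x. \<sigma> k x - \<sigma> l x) (\<lambda>x. \<sigma> k x - \<sigma> l x) < e\<^sup>2" using c by simp
      then show ?thesis
        unfolding hilbert_norm_def using e real_sqrt_less_mono by fastforce
    qed
    then show "\<exists>M. \<forall>k\<ge>M. \<forall>l\<ge>M. hilbert_norm ip (\<lambda>x. \<sigma> k x - \<sigma> l x) < e" by blast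
  qed
  then obtain f where f: "f \<in> H" and lim: "(\<lambda>k. hilbert_norm ip (\<lambda>x. \<sigma> k x - f x)) \<longlonglongrightarrow> 0"
    by blast
  have "(\<lambda>k. m + 1 / real (Suc k)) \<longlonglongrightarrow> m"
    using tendsto_add[OF tendsto_const LIMSEQ_Suc[OF lim_1_over_n], of m] by simp
  then have "J f \<le> m"
    using J\<sigma> by (intro LIMSEQ_le[OF cont[OF \<sigma> f lim]]) (auto intro: less_imp_le)
  then show ?thesis
    unfolding is_arg_min_linorder using f lower by (meson order_trans)
qed

end

section \<open>Kernels that are continuous on a compact interval\<close>

locale continuous_rkhs =
  fixes T :: real and K :: "real \<Rightarrow> real \<Rightarrow> real^'d^'d" and H ip
  assumes rkhs: "is_rkhs {0..T} K H ip"
    and kernel_continuous: "continuous_on ({0..T} \<times> {0..T}) (\<lambda>(x, x'). K x x')"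

sublocale continuous_rkhs \<subseteq> hilbert_functions "{0..T}" H ip
  using rkhs by unfold_locales (simp add: is_rkhs_def)

context continuous_rkhs
begin

abbreviation "\<Phi> \<equiv> feature_map {0..T} K"

lemma feature_mem: "x \<in> {0..T} \<Longrightarrow> \<Phi> x v \<in> H"
  and reproducing: "x \<in> {0..T} \<Longrightarrow> \<phi> \<in> H \<Longrightarrow> ip \<phi> (\<Phi> x v) = \<phi> x \<bullet> v"
  and kernel_symmetric: "x \<in> {0..T} \<Longrightarrow> x' \<in> {0..T} \<Longrightarrow> K x x' = transpose (K x' x)"
  using rkhs unfolding is_rkhs_def reproducing_kernel_def by blast+

lemma ip_feature:
  assumes "x \<in> {0..T}" "x' \<in> {0..T}"
  shows "ip (\<Phi> x v) (\<Phi> x' w) = (K x' x *v v) \<bullet> w"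
  using reproducing[OF assms(2) feature_mem[OF assms(1)]] assms(2) by (simp add: feature_map_def)

text \<open>A scalar entry of the kernel is a linear, hence bounded, function of the matrix. The two
  inner functions \<open>f\<close> and \<open>g\<close> cover both the diagonal and the sections of
  \<open>K\<close>.\<close>

lemma quadratic_form_continuous:
  assumes "continuous_on S f" "continuous_on S g" "f ` S \<subseteq> {0..T}" "g ` S \<subseteq> {0..T}"
  shows "continuous_on S (\<lambda>s. (K (f s) (g s) *v v) \<bullet> w)"
proof -
  have "continuous_on S (\<lambda>s. (f s, g s))"
    by (intro continuous_on_Pair assms)
  then have "continuous_on S (\<lambda>s. K (f s) (g s))"
    using continuous_on_compose2[OF kernel_continuous, of S "\<lambda>s. (f s, g s)"] assms(3,4) by auto
  moreover have "bounded_linear (\<lambda>A :: real^'d^'d. (A *v v) \<bullet> w)"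
    by (rule linear_conv_bounded_linear[THEN iffD1], rule linearI)
       (simp_all add: matrix_vector_mult_add_rdistrib inner_add_left scaleR_matrix_vector_assoc[symmetric])
  ultimately show ?thesis
    by (rule bounded_linear.continuous_on[rotated])
qed

text \<open>By the reproducing property and Cauchy-Schwarz, the increment of \<open>\<phi>\<close>
  in direction \<open>b\<close> is at most the norm of \<open>\<phi>\<close> times the distance of
  two features, and that distance depends continuously on the points through
  \<open>K\<close>.\<close>

lemma hilbert_element_continuous:
  assumes \<phi>: "\<phi> \<in> H" shows "continuous_on {0..T} \<phi>"
  unfolding continuous_on_def
proof
  fix x assume x: "x \<in> {0..T}"
  have "((\<lambda>s. \<phi> s \<bullet> b) \<longlongrightarrow> \<phi> x \<bullet> b) (at x within {0..T})" for b
  proof -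
    define q where "q s s' = (K s s' *v b) \<bullet> b" for s s'
    \<comment> \<open>The squared distance between the features at \<open>s\<close> and at
      \<open>x\<close>.\<close>
    define D where "D s = q s s - 2 * q x s + q x x" for s
    have D: "hilbert_norm ip (\<lambda>u. \<Phi> s b u - \<Phi> x b u) = sqrt (D s)" if "s \<in> {0..T}" for s
      using that x by (simp add: hilbert_norm_def ip_diff_self feature_mem ip_feature D_def q_def)
    have c1: "continuous_on {0..T} (\<lambda>s. q s s)"
      unfolding q_def by (rule quadratic_form_continuous) auto
    have c2: "continuous_on {0..T} (\<lambda>s. q x s)"
      unfolding q_def using x by (intro quadratic_form_continuous) auto
    have "continuous_on {0..T} (\<lambda>s. hilbert_norm ip \<phi> * sqrt (D s))"
      unfolding D_def by (intro continuous_intros c1 c2)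
    then have "((\<lambda>s. hilbert_norm ip \<phi> * sqrt (D s)) \<longlongrightarrow> 0) (at x within {0..T})"
      \<comment> \<open>The limit is 0 because \<open>D x = 0\<close>.\<close>
      using x by (auto simp: continuous_on_def D_def dest!: bspec)
    moreover have "\<forall>\<^sub>F s in at x within {0..T}. norm (\<phi> s \<bullet> b - \<phi> x \<bullet> b) \<le> hilbert_norm ip \<phi> * sqrt (D s)"
      unfolding eventually_at_topological
    proof (intro exI[of _ UNIV] conjI ballI impI)
      fix s assume s: "s \<in> {0..T}"
      show "norm (\<phi> s \<bullet> b - \<phi> x \<bullet> b) \<le> hilbert_norm ip \<phi> * sqrt (D s)"
        using Cauchy_Schwarz[OF \<phi> diff_mem[OF feature_mem[OF s, of b] feature_mem[OF x, of b]]] s x \<phi>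
        by (simp add: D ip_diff_right feature_mem reproducing)
    qed auto
    ultimately have "((\<lambda>s. \<phi> s \<bullet> b - \<phi> x \<bullet> b) \<longlongrightarrow> 0) (at x within {0..T})"
      by (rule Lim_null_comparison[rotated])
    then show ?thesis by (simp add: LIM_zero_iff)
  qed
  then show "(\<phi> \<longlongrightarrow> \<phi> x) (at x within {0..T})"
    by (subst tendsto_componentwise_iff) blast
qed

section \<open>Boundedness of point evaluations and of the integral operators\<close>

lemma hilbert_element_integrable:
  assumes "\<phi> \<in> H" "\<tau> \<in> {0..T}" shows "\<phi> integrable_on {0..\<tau>}"
  by (intro integrable_continuous_real continuous_on_subset[OF hilbert_element_continuous[OF assms(1)]])
     (use assms(2) in auto)

lemma integral_op_lincomb:
  assumes "f \<in> H" "g \<in> H" "\<tau> \<in> {0..T}"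
  shows "integral_op \<tau> (\<lambda>x. f x + c *\<^sub>R g x) = integral_op \<tau> f + c *\<^sub>R integral_op \<tau> g"
  unfolding integral_op_def
  using integral_add[OF hilbert_element_integrable[OF assms(1,3)]
      integrable_cmul[OF hilbert_element_integrable[OF assms(2,3)], of c]]
  by simp

text \<open>The squared norm of the feature at \<open>x\<close> in direction \<open>b\<close> is a
  diagonal value of the kernel, and the diagonal is bounded by compactness. Hence one constant
  serves all points.\<close>

lemma evaluation_bounded: "\<exists>C\<ge>0. \<forall>\<phi>\<in>H. \<forall>x\<in>{0..T}. norm (\<phi> x) \<le> C * hilbert_norm ip \<phi>"
proof -
  have "\<exists>C\<ge>0. \<forall>\<phi>\<in>H. \<forall>x\<in>{0..T}. \<bar>\<phi> x \<bullet> b\<bar> \<le> C * hilbert_norm ip \<phi>" for b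
  proof -
    have "continuous_on {0..T} (\<lambda>s. (K s s *v b) \<bullet> b)"
      by (rule quadratic_form_continuous) auto
    then have "bounded ((\<lambda>s. (K s s *v b) \<bullet> b) ` {0..T})"
      by (intro compact_imp_bounded compact_continuous_image) auto
    then obtain B where B: "\<And>s. s \<in> {0..T} \<Longrightarrow> \<bar>(K s s *v b) \<bullet> b\<bar> \<le> B"
      unfolding bounded_iff by force
    \<comment> \<open>The absolute value makes the constant nonnegative whichever bound
      \<open>B\<close> was obtained.\<close>
    have "\<bar>\<phi> x \<bullet> b\<bar> \<le> sqrt \<bar>B\<bar> * hilbert_norm ip \<phi>" if \<phi>: "\<phi> \<in> H" and x: "x \<in> {0..T}" for \<phi> x
    proof -
      have "\<bar>\<phi> x \<bullet> b\<bar> \<le> hilbert_norm ip \<phi> * sqrt ((K x x *v b) \<bullet> b)"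
        using Cauchy_Schwarz[OF \<phi> feature_mem[OF x, of b]] \<phi> x
        by (simp add: reproducing hilbert_norm_def ip_feature)
      also have "\<dots> \<le> hilbert_norm ip \<phi> * sqrt \<bar>B\<bar>"
        using B[OF x] by (intro mult_left_mono hilbert_norm_nonneg \<phi>) auto
      finally show ?thesis by (simp add: mult.commute)
    qed
    then show ?thesis by (intro exI[of _ "sqrt \<bar>B\<bar>"]) auto
  qed
  then obtain C where C0: "\<And>b. C b \<ge> 0"
    and C: "\<And>b \<phi> x. \<phi> \<in> H \<Longrightarrow> x \<in> {0..T} \<Longrightarrow> \<bar>\<phi> x \<bullet> b\<bar> \<le> C b * hilbert_norm ip \<phi>"
    by metis
  have "norm (\<phi> x) \<le> (\<Sum>b\<in>Basis. C b) * hilbert_norm ip \<phi>" if "\<phi> \<in> H" "x \<in> {0..T}" for \<phi> x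
    unfolding sum_distrib_right
    using norm_le_l1[of "\<phi> x"] sum_mono[of Basis "\<lambda>b. \<bar>\<phi> x \<bullet> b\<bar>" "\<lambda>b. C b * hilbert_norm ip \<phi>"] C[OF that]
    by force
  then show ?thesis using C0 by (meson sum_nonneg)
qed

text \<open>The uniform evaluation bound integrates to the operator bound \<open>C * \<tau>\<close>,
  applied to the difference of \<open>\<sigma> k\<close> and \<open>f\<close>.\<close>

lemma tendsto_integral_op:
  assumes \<sigma>: "\<And>k. \<sigma> k \<in> H" and f: "f \<in> H" and \<tau>: "\<tau> \<in> {0..T}"
    and lim: "(\<lambda>k. hilbert_norm ip (\<lambda>x. \<sigma> k x - f x)) \<longlonglongrightarrow> 0"
  shows "(\<lambda>k. integral_op \<tau> (\<sigma> k)) \<longlonglongrightarrow> integral_op \<tau> f"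
proof -
  obtain C where C: "\<And>\<phi> x. \<phi> \<in> H \<Longrightarrow> x \<in> {0..T} \<Longrightarrow> norm (\<phi> x) \<le> C * hilbert_norm ip \<phi>"
    using evaluation_bounded by blast
  have "norm (integral_op \<tau> (\<sigma> k) - integral_op \<tau> f)
      \<le> C * hilbert_norm ip (\<lambda>x. \<sigma> k x - f x) * (\<tau> - 0)" for k
  proof -
    have d: "(\<lambda>x. \<sigma> k x - f x) \<in> H" by (intro diff_mem \<sigma> f)
    have "integral_op \<tau> (\<sigma> k) - integral_op \<tau> f = integral {0..\<tau>} (\<lambda>x. \<sigma> k x - f x)"
      using integral_op_lincomb[OF \<sigma> f \<tau>, of k "-1"] by (simp add: integral_op_def)
    also have "norm \<dots> \<le> C * hilbert_norm ip (\<lambda>x. \<sigma> k x - f x) * (\<tau> - 0)"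
      using \<tau> C[OF d]
      by (intro integral_bound continuous_on_subset[OF hilbert_element_continuous[OF d]]) auto
    finally show ?thesis .
  qed
  moreover have "(\<lambda>k. C * hilbert_norm ip (\<lambda>x. \<sigma> k x - f x) * (\<tau> - 0)) \<longlonglongrightarrow> 0"
    using lim by (auto intro!: tendsto_eq_intros)
  ultimately have "(\<lambda>k. integral_op \<tau> (\<sigma> k) - integral_op \<tau> f) \<longlonglongrightarrow> 0"
    by (rule Lim_null_comparison[OF always_eventually[OF allI]])
  then show ?thesis by (simp add: LIM_zero_iff)
qed

text \<open>Symmetry of the kernel exchanges the roles of \<open>v\<close> and \<open>w\<close>
  under the integral, and inner products with fixed vectors commute with integration. Since
  \<open>ip F (\<Phi> u w) = F u \<bullet> w\<close> for \<open>F\<close> in \<open>H\<close>, this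
  is how the representer of \<open>\<phi> \<mapsto> v \<bullet> integral_op \<tau> \<phi>\<close>
  must act pointwise.\<close>

lemma integral_op_feature:
  assumes u: "u \<in> {0..T}" and \<tau>: "\<tau> \<in> {0..T}"
  shows "v \<bullet> integral_op \<tau> (\<Phi> u w) = integral_feature {0..T} K \<tau> v u \<bullet> w"
proof -
  have sym: "v \<bullet> \<Phi> u w s = \<Phi> s v u \<bullet> w" if "s \<in> {0..\<tau>}" for s
  proof -
    have s: "s \<in> {0..T}" using that \<tau> by auto
    have "v \<bullet> (K s u *v w) = (transpose (K s u) *v v) \<bullet> w"
      by (simp only: transpose_matrix_vector dot_lmul_matrix)
    then show ?thesis using s u kernel_symmetric[OF u s] by (simp add: feature_map_def)
  qed
  \<comment> \<open>Here the integration variable is the second kernel argument, so the integrand is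
    not literally a feature in \<open>H\<close>; its integrability is derived from the continuity of
    \<open>K\<close>, component by component.\<close>
  have "continuous_on {0..T} (\<lambda>s. (K u s *v v) \<bullet> b)" for b
    using u by (intro quadratic_form_continuous) auto
  then have "continuous_on {0..T} (\<lambda>s. K u s *v v)"
    by (subst continuous_on_componentwise) blast
  then have "continuous_on {0..\<tau>} (\<lambda>s. K u s *v v)"
    using \<tau> by (auto elim: continuous_on_subset)
  then have int: "(\<lambda>s. \<Phi> s v u) integrable_on {0..\<tau>}"
    using u by (simp add: feature_map_def integrable_continuous_real)
  have "v \<bullet> integral_op \<tau> (\<Phi> u w) = integral {0..\<tau>} (\<lambda>s. v \<bullet> \<Phi> u w s)"
    unfolding integral_op_def
    using integral_linear[OF hilbert_element_integrable[OF feature_mem[OF u] \<tau>] bounded_linear_inner_right]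
    by (simp add: o_def)
  also have "\<dots> = integral {0..\<tau>} (\<lambda>s. \<Phi> s v u \<bullet> w)"
    by (intro integral_cong sym)
  also have "\<dots> = integral_feature {0..T} K \<tau> v u \<bullet> w"
    unfolding integral_feature_def integral_op_def
    using integral_linear[OF int bounded_linear_inner_left] by (simp add: o_def)
  finally show ?thesis .
qed

end

section \<open>The regularized risk\<close>

lemma midpoint_eq: "(1/2) *\<^sub>R (a + b) = a + (1/2) *\<^sub>R (b - a)" for a b :: "'a::real_vector"
proof -
  have "a = (1/2) *\<^sub>R a + (1/2) *\<^sub>R a"
    unfolding scaleR_left_distrib[symmetric] by simp
  then show ?thesis
    unfolding scaleR_right_distrib scaleR_right_diff_distrib
    by (metis add.commute add_diff_eq add_diff_cancel_left')
qed

lemma norm_square_lincomb: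
  "(norm (a + c *\<^sub>R b - y))\<^sup>2 = (norm (a - y))\<^sup>2 + 2 * c * ((a - y) \<bullet> b) + c\<^sup>2 * (norm b)\<^sup>2"
  for a b y :: "'a::real_inner"
proof -
  have eq: "a + c *\<^sub>R b - y = (a - y) + c *\<^sub>R b" by simp
  have "(norm (a + c *\<^sub>R b - y))\<^sup>2 = (norm (a - y))\<^sup>2 + 2 * ((a - y) \<bullet> c *\<^sub>R b) + (norm (c *\<^sub>R b))\<^sup>2"
    unfolding eq dot_norm[of "a - y" "c *\<^sub>R b"] by argo
  then show ?thesis by (simp add: power_mult_distrib)
qed

text \<open>Near \<open>c = 0\<close> the linear term dominates, so its coefficient cannot have a
  sign. This stands in for differentiating the risk at a minimizer.\<close>

lemma linear_coefficient_zero: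
  fixes A B :: real
  assumes B: "B \<ge> 0" and nonneg: "\<And>c. 0 \<le> 2 * c * A + c\<^sup>2 * B"
  shows "A = 0"
proof -
  \<comment> \<open>The denominator \<open>B + 1\<close> in place of \<open>B\<close> covers the
    case \<open>B = 0\<close> as well.\<close>
  have "0 \<le> 2 * (- A / (B + 1)) * A + (- A / (B + 1))\<^sup>2 * B" by (rule nonneg)
  also have "\<dots> = - (A\<^sup>2 * (B + 2)) / (B + 1)\<^sup>2"
    using B by (simp add: power2_eq_square add_nonneg_eq_0_iff divide_simps) (simp add: algebra_simps)
  finally have "A\<^sup>2 * (B + 2) / (B + 1)\<^sup>2 \<le> 0" by simp
  moreover have "(B + 1)\<^sup>2 > 0" using B by simp
  ultimately have "A\<^sup>2 * (B + 2) \<le> 0" by (meson divide_pos_pos leI not_le)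
  then have "A\<^sup>2 \<le> 0" using B by (simp add: mult_le_0_iff)
  then show ?thesis by simp
qed

section \<open>Expansion of the risk, existence and form of its minimizers\<close>

locale regularized_integral_regression = continuous_rkhs T K H ip
  for T and K :: "real \<Rightarrow> real \<Rightarrow> real^'d^'d" and H ip +
  fixes n :: nat and t :: "nat \<Rightarrow> real" and y :: "nat \<Rightarrow> real^'d" and lam :: real
  assumes nodes: "i \<in> {1..n} \<Longrightarrow> t i \<in> {0..T}"
    and lam_pos: "lam > 0"
begin

abbreviation "J \<equiv> regularized_risk ip n t y lam"

lemma risk_eq:
  "\<phi> \<in> H \<Longrightarrow> J \<phi> = (\<Sum>i=1..n. (norm (integral_op (t i) \<phi> - y i))\<^sup>2) + lam * ip \<phi> \<phi>"
  by (simp add: regularized_risk_def hilbert_norm_square)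

text \<open>An exact second-order expansion, since every \<open>integral_op (t i)\<close> is linear
  on \<open>H\<close>. The linear coefficient yields the first variation, the quadratic one the
  modulus of convexity.\<close>

lemma risk_lincomb:
  assumes f: "f \<in> H" and g: "g \<in> H"
  shows "J (\<lambda>x. f x + c *\<^sub>R g x) = J f
    + 2 * c * ((\<Sum>i=1..n. (integral_op (t i) f - y i) \<bullet> integral_op (t i) g) + lam * ip f g)
    + c\<^sup>2 * ((\<Sum>i=1..n. (norm (integral_op (t i) g))\<^sup>2) + lam * ip g g)"
proof -
  have "(norm (integral_op (t i) (\<lambda>x. f x + c *\<^sub>R g x) - y i))\<^sup>2
      = (norm (integral_op (t i) f - y i))\<^sup>2
        + 2 * c * ((integral_op (t i) f - y i) \<bullet> integral_op (t i) g)
        + c\<^sup>2 * (norm (integral_op (t i) g))\<^sup>2" if "i \<in> {1..n}" for i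
    unfolding integral_op_lincomb[OF f g nodes[OF that]] by (rule norm_square_lincomb)
  then have "(\<Sum>i=1..n. (norm (integral_op (t i) (\<lambda>x. f x + c *\<^sub>R g x) - y i))\<^sup>2)
      = (\<Sum>i=1..n. (norm (integral_op (t i) f - y i))\<^sup>2)
        + 2 * c * (\<Sum>i=1..n. (integral_op (t i) f - y i) \<bullet> integral_op (t i) g)
        + c\<^sup>2 * (\<Sum>i=1..n. (norm (integral_op (t i) g))\<^sup>2)"
    unfolding sum_distrib_left sum.distrib[symmetric] by (rule sum.cong[OF refl])
  then show ?thesis
    unfolding risk_eq[OF f] risk_eq[OF lincomb_mem[OF f g]] ip_lincomb_self[OF f g]
    by (simp only: distrib_left mult_ac add_ac)
qed

text \<open>Let \<open>A\<close> and \<open>B\<close> be the brackets after \<open>2 * c\<close> and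
  \<open>c\<^sup>2\<close> in the expansion from \<open>f\<close> towards \<open>g\<close>. The
  values \<open>c = 1/2\<close> and \<open>c = 1\<close> give \<open>J f + A + B / 4\<close> at the
  midpoint and \<open>J g = J f + 2 * A + B\<close>, so the gap is exactly \<open>B / 4\<close>, and
  \<open>B\<close> is at least \<open>lam * ip h h\<close>.\<close>

lemma risk_strongly_convex:
  assumes f: "f \<in> H" and g: "g \<in> H"
  shows "J (\<lambda>x. (1/2) *\<^sub>R (f x + g x))
    \<le> (J f + J g) / 2 - lam / 4 * ip (\<lambda>x. f x - g x) (\<lambda>x. f x - g x)"
proof -
  define h where "h = (\<lambda>x. g x - f x)"
  have h: "h \<in> H" unfolding h_def by (intro diff_mem f g)
  have mid: "(\<lambda>x. (1/2) *\<^sub>R (f x + g x)) = (\<lambda>x. f x + (1/2) *\<^sub>R h x)"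
    unfolding h_def by (intro ext midpoint_eq)
  have g_eq: "g = (\<lambda>x. f x + 1 *\<^sub>R h x)" by (simp add: h_def)
  have sym: "ip (\<lambda>x. f x - g x) (\<lambda>x. f x - g x) = ip h h"
    using f g by (simp add: h_def ip_diff_self ip_commute[of g f])
  have "0 \<le> (\<Sum>i=1..n. (norm (integral_op (t i) h))\<^sup>2)" by (simp add: sum_nonneg)
  moreover have "J g = J (\<lambda>x. f x + 1 *\<^sub>R h x)" using g_eq by simp
  ultimately show ?thesis
    unfolding mid sym risk_lincomb[OF f h] by (simp add: power2_eq_square algebra_simps)
qed

lemma risk_has_arg_min: "\<exists>\<phi>. is_arg_min J (\<lambda>\<phi>. \<phi> \<in> H) \<phi>"
proof (rule strongly_convex_has_arg_min[where c = "lam / 4"])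
  show "0 \<le> J f" if "f \<in> H" for f
    using that lam_pos by (simp add: risk_eq sum_nonneg ip_nonneg)
  show "(\<lambda>k. J (\<sigma> k)) \<longlonglongrightarrow> J f" if \<sigma>: "\<And>k. \<sigma> k \<in> H" and f: "f \<in> H"
    and lim: "(\<lambda>k. hilbert_norm ip (\<lambda>x. \<sigma> k x - f x)) \<longlonglongrightarrow> 0" for \<sigma> f
    unfolding risk_eq[OF \<sigma>] risk_eq[OF f]
    by (intro tendsto_intros tendsto_integral_op[OF \<sigma> f nodes lim] tendsto_ip_self[OF \<sigma> f lim])
qed (use lam_pos risk_strongly_convex in auto)

text \<open>Along the line through the minimizer in direction \<open>h\<close> the increment of the
  risk is a nonnegative quadratic polynomial without constant term.\<close>

lemma arg_min_first_variation:
  assumes min: "is_arg_min J (\<lambda>\<phi>. \<phi> \<in> H) \<phi>" and h: "h \<in> H"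
  shows "(\<Sum>i=1..n. (integral_op (t i) \<phi> - y i) \<bullet> integral_op (t i) h) + lam * ip \<phi> h = 0"
    (is "?A = 0")
proof -
  have \<phi>: "\<phi> \<in> H" and le: "\<And>\<psi>. \<psi> \<in> H \<Longrightarrow> J \<phi> \<le> J \<psi>"
    using min by (auto simp: is_arg_min_linorder)
  define B where "B = (\<Sum>i=1..n. (norm (integral_op (t i) h))\<^sup>2) + lam * ip h h"
  have B: "B \<ge> 0" unfolding B_def using h lam_pos by (simp add: sum_nonneg ip_nonneg)
  have "0 \<le> 2 * c * ?A + c\<^sup>2 * B" for c
    using le[OF lincomb_mem[OF \<phi> h, of c]] risk_lincomb[OF \<phi> h, of c] by (simp add: B_def)
  then show ?thesis by (rule linear_coefficient_zero[OF B])
qed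

lemma arg_min_representation:
  assumes min: "is_arg_min J (\<lambda>\<phi>. \<phi> \<in> H) \<phi>"
  shows "\<phi> = (\<lambda>u. \<Sum>i=1..n. integral_feature {0..T} K (t i) ((1 / lam) *\<^sub>R (y i - integral_op (t i) \<phi>)) u)"
    (is "_ = (\<lambda>u. \<Sum>i=1..n. ?F i u)")
proof
  fix u
  have \<phi>: "\<phi> \<in> H" using min by (simp add: is_arg_min_linorder)
  show "\<phi> u = (\<Sum>i=1..n. ?F i u)"
  proof (cases "u \<in> {0..T}")
    case False
    then show ?thesis
      \<comment> \<open>Both sides vanish outside the interval: features are extended by 0 there, so
        each integrand is 0.\<close>
      using outside[OF \<phi>] by (auto simp: integral_feature_def integral_op_def feature_map_def)
  next
    case u: True
    show ?thesis
    proof (rule vector_eq_rdot[THEN iffD1], rule allI)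
      fix w
      have "(\<Sum>i=1..n. ?F i u) \<bullet> w
          = (\<Sum>i=1..n. ((1 / lam) *\<^sub>R (y i - integral_op (t i) \<phi>)) \<bullet> integral_op (t i) (\<Phi> u w))"
        unfolding inner_sum_left by (intro sum.cong refl integral_op_feature[symmetric] u nodes)
      also have "\<dots> = - (1 / lam) * (\<Sum>i=1..n. (integral_op (t i) \<phi> - y i) \<bullet> integral_op (t i) (\<Phi> u w))"
        unfolding sum_distrib_left by (intro sum.cong refl) (simp add: inner_diff_left algebra_simps)
      \<comment> \<open>The first variation in direction \<open>\<Phi> u w\<close> equates the sum
        with \<open>- lam * ip \<phi> (\<Phi> u w)\<close>, and the reproducing property evaluates
        the inner product.\<close>
      also have "\<dots> = \<phi> u \<bullet> w"
        using arg_min_first_variation[OF min feature_mem[OF u, of w]] reproducing[OF u \<phi>, of w] lam_pos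
        by (simp add: field_simps)
      finally show "\<phi> u \<bullet> w = (\<Sum>i=1..n. ?F i u) \<bullet> w" by simp
    qed
  qed
qed

end

theorem theorem3p2:
  fixes T lam :: real
    and K :: "real \<Rightarrow> real \<Rightarrow> real^'d^'d"
    and H :: "(real \<Rightarrow> real^'d) set"
    and ip :: "(real \<Rightarrow> real^'d) \<Rightarrow> (real \<Rightarrow> real^'d) \<Rightarrow> real"
    and n :: nat
    and t :: "nat \<Rightarrow> real"
    and y :: "nat \<Rightarrow> real^'d"
  assumes "T > 0"
    and "is_rkhs {0..T} K H ip"
    and "continuous_on ({0..T} \<times> {0..T}) (\<lambda>(x, x'). K x x')"
    and "\<And>i. i \<in> {1..n} \<Longrightarrow> t i \<in> {0..T}"
    and "lam > 0"
  shows "(\<exists>\<phi>. is_arg_min (regularized_risk ip n t y lam) (\<lambda>\<phi>. \<phi> \<in> H) \<phi>) \<and>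
    (\<forall>\<phi>. is_arg_min (regularized_risk ip n t y lam) (\<lambda>\<phi>. \<phi> \<in> H) \<phi> \<longrightarrow>
       (\<exists>v :: nat \<Rightarrow> real^'d.
          \<phi> = (\<lambda>u. \<Sum>i=1..n. integral_feature {0..T} K (t i) (v i) u)))"
proof -
  interpret regularized_integral_regression T K H ip n t y lam
    using assms by unfold_locales auto
  \<comment> \<open>The predicate for \<open>exI\<close> is spelled out so that the witness
    \<open>v\<close> is the whole family of scaled residuals, as a function of the index.\<close>
  show ?thesis
    using risk_has_arg_min
      exI[of "\<lambda>v. _ = (\<lambda>u. \<Sum>i=1..n. integral_feature {0..T} K (t i) (v i) u)", OF arg_min_representation]
    by blast
qed

end
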